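(* For any nominal transition system $\mathbf T$ and states $P,Q$: if $P\stackrel{\cdot}{\sim}_{\mathcal S(\mathbf T)}Q$ then $P\stackrel{\cdot}{\sim}_{\mathbf T}Q$.
   Context: Nominal sets over a countably infinite (possibly sorted) set of names $\mathcal N$: permutations fix all but finitely many names; every element has finite support $\operatorname{supp}$; $a\# X$ means $a\notin\operatorname{supp}(X)$; $[\mathcal P_{\mathrm{fin}}(\mathcal N)]S$ is $\mathcal P_{\mathrm{fin}}(\mathcal N)\times S$ modulo $(N,X)=_\alpha(N',X')$ iff some $\pi$ with $\pi\cdot(N,X)=(N',X')$ fixes every name of $\operatorname{supp}(X)\setminus N$; classes $\langle N\rangle X$. A nominal transition system: nominal sets STATES, PRED, ACT; equivariant $\vdash\subseteq\mathrm{STATES}\times\mathrm{PRED}$; equivariant $\operatorname{bn}$, $\operatorname{bn}(\alpha)$ a finite subset of $\operatorname{supp}(\alpha)$; equivariant $\rightarrow\ \subseteq\mathrm{STATES}\times[\mathcal P_{\mathrm{fin}}(\mathcal N)](\mathrm{ACT}\times\mathrm{STATES})$ with $(P,\langle N\rangle(\alpha,Q))\in\rightarrow$ only if $N=\operatorname{bn}(\alpha)$; $P\xrightarrow{\alpha}P'$ means $(P,\langle\operatorname{bn}(\alpha)\rangle(\alpha,P'))\in\rightarrow$. A bisimulation is a symmetric relation $R$ on states with: $R(P,Q)$ implies (1) $P\vdash\varphi\Rightarrow Q\vdash\varphi$ for all $\varphi$; (2) whenever $\operatorname{bn}(\alpha)\# Q$ and $P\xrightarrow{\alpha}P'$, some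 $Q'$ has $Q\xrightarrow{\alpha}Q'$ and $R(P',Q')$. $\stackrel{\cdot}{\sim}_{\mathbf T}$ is bisimilarity in $\mathbf T$. $\mathcal S(\mathbf T)$ is the nominal transition system with: $\mathrm{STATES}_{\mathcal S(\mathbf T)}=\mathrm{STATES}_{\mathbf T}$; $\mathrm{ACT}_{\mathcal S(\mathbf T)}=\mathrm{ACT}_{\mathbf T}\uplus\mathrm{PRED}_{\mathbf T}$; $\operatorname{bn}$ as in $\mathbf T$ on $\mathrm{ACT}_{\mathbf T}$ and $\operatorname{bn}(\varphi)=\emptyset$ for $\varphi\in\mathrm{PRED}_{\mathbf T}$; no state predicates hold; transitions $P\xrightarrow{\alpha}P'$ in $\mathcal S(\mathbf T)$ iff $P\xrightarrow{\alpha}P'$ in $\mathbf T$ (for $\alpha\in\mathrm{ACT}_{\mathbf T}$), and $P\xrightarrow{\varphi}P$ iff $P\vdash_{\mathbf T}\varphi$ (for $\varphi\in\mathrm{PRED}_{\mathbf T}$), with no other $\varphi$-transitions. *)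

theory Defs
  imports "HOL-Library.Countable_Set" "HOL-Combinatorics.Perm"
begin

section \<open>Names and permutations\<close>

text \<open>
  The names are the elements of a type \<open>'n\<close>, sorted by a function \<open>srt\<close>; the unsorted case is
  that of a constant \<open>srt\<close>. As usual for sorted names, every sort that occurs has infinitely many
  names and permutations respect sorts. Elements of \<open>'n perm\<close> are by definition bijections that
  fix all but finitely many names.
\<close>

definition name_sorting :: "('n \<Rightarrow> 'k) \<Rightarrow> bool" where
  "name_sorting srt \<longleftrightarrow>
     countable (UNIV :: 'n set) \<and> infinite (UNIV :: 'n set) \<and>
     (\<forall>a. infinite {b. srt b = srt a})"

definition perms :: "('n \<Rightarrow> 'k) \<Rightarrow> 'n perm set" where
  "perms srt = {\<pi>. \<forall>a. srt (Perm.apply \<pi> a) = srt a}"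


section \<open>Nominal sets\<close>

record ('n, 'x) nset =
  elems :: "'x set"
  act :: "'n perm \<Rightarrow> 'x \<Rightarrow> 'x"

definition supports :: "('n \<Rightarrow> 'k) \<Rightarrow> ('n, 'x) nset \<Rightarrow> 'n set \<Rightarrow> 'x \<Rightarrow> bool" where
  "supports srt X N x \<longleftrightarrow>
     (\<forall>\<pi>\<in>perms srt. (\<forall>a\<in>N. Perm.apply \<pi> a = a) \<longrightarrow> act X \<pi> x = x)"

definition nominal_set :: "('n \<Rightarrow> 'k) \<Rightarrow> ('n, 'x) nset \<Rightarrow> bool" where
  "nominal_set srt X \<longleftrightarrow>
     (\<forall>\<pi>\<in>perms srt. \<forall>x\<in>elems X. act X \<pi> x \<in> elems X) \<and>
     (\<forall>x\<in>elems X. act X 1 x = x) \<and>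
     (\<forall>\<pi>\<in>perms srt. \<forall>\<sigma>\<in>perms srt. \<forall>x\<in>elems X. act X (\<pi> * \<sigma>) x = act X \<pi> (act X \<sigma> x)) \<and>
     (\<forall>x\<in>elems X. \<exists>N. finite N \<and> supports srt X N x)"

text \<open>In a nominal set the intersection below is itself finite and supporting, hence least.\<close>

definition supp :: "('n \<Rightarrow> 'k) \<Rightarrow> ('n, 'x) nset \<Rightarrow> 'x \<Rightarrow> 'n set" where
  "supp srt X x = \<Inter> {N. finite N \<and> supports srt X N x}"

definition fresh :: "('n \<Rightarrow> 'k) \<Rightarrow> ('n, 'x) nset \<Rightarrow> 'n \<Rightarrow> 'x \<Rightarrow> bool" where
  "fresh srt X a x \<longleftrightarrow> a \<notin> supp srt X x"

definition prod_nset :: "('n, 'x) nset \<Rightarrow> ('n, 'y) nset \<Rightarrow> ('n, 'x \<times> 'y) nset" where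
  "prod_nset X Y = \<lparr>elems = elems X \<times> elems Y, act = (\<lambda>\<pi>. map_prod (act X \<pi>) (act Y \<pi>))\<rparr>"

definition sum_nset :: "('n, 'x) nset \<Rightarrow> ('n, 'y) nset \<Rightarrow> ('n, 'x + 'y) nset" where
  "sum_nset X Y = \<lparr>elems = elems X <+> elems Y, act = (\<lambda>\<pi>. map_sum (act X \<pi>) (act Y \<pi>))\<rparr>"

definition fin_names :: "('n, 'n set) nset" where
  "fin_names = \<lparr>elems = Fpow UNIV, act = (\<lambda>\<pi>. image (Perm.apply \<pi>))\<rparr>"

definition equivariant ::
    "('n \<Rightarrow> 'k) \<Rightarrow> ('n, 'x) nset \<Rightarrow> ('n, 'y) nset \<Rightarrow> ('x \<times> 'y) set \<Rightarrow> bool" where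
  "equivariant srt X Y R \<longleftrightarrow>
     (\<forall>\<pi>\<in>perms srt. \<forall>x y. (x, y) \<in> R \<longrightarrow> (act X \<pi> x, act Y \<pi> y) \<in> R)"

definition equivariant_fun ::
    "('n \<Rightarrow> 'k) \<Rightarrow> ('n, 'x) nset \<Rightarrow> ('n, 'y) nset \<Rightarrow> ('x \<Rightarrow> 'y) \<Rightarrow> bool" where
  "equivariant_fun srt X Y f \<longleftrightarrow>
     (\<forall>\<pi>\<in>perms srt. \<forall>x\<in>elems X. f (act X \<pi> x) = act Y \<pi> (f x))"


section \<open>Name abstraction\<close>

definition alpha :: "('n \<Rightarrow> 'k) \<Rightarrow> ('n, 'x) nset \<Rightarrow> (('n set \<times> 'x) \<times> ('n set \<times> 'x)) set" where
  "alpha srt X =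
     {((N, x), (N', x')).
        (N, x) \<in> elems (prod_nset fin_names X) \<and> (N', x') \<in> elems (prod_nset fin_names X) \<and>
        (\<exists>\<pi>\<in>perms srt. act (prod_nset fin_names X) \<pi> (N, x) = (N', x') \<and>
           (\<forall>a\<in>supp srt X x - N. Perm.apply \<pi> a = a))}"

text \<open>For arguments outside the carriers, \<open>absc srt X N x\<close> is empty and so not in the quotient.\<close>

definition absc :: "('n \<Rightarrow> 'k) \<Rightarrow> ('n, 'x) nset \<Rightarrow> 'n set \<Rightarrow> 'x \<Rightarrow> ('n set \<times> 'x) set" where
  "absc srt X N x = alpha srt X `` {(N, x)}"

text \<open>
  The elementwise image of the class of \<open>(N, x)\<close> under a permutation \<open>\<pi>\<close> is the class
  of \<open>(\<pi> \<cdot> N, \<pi> \<cdot> x)\<close>.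
\<close>

definition abs_nset :: "('n \<Rightarrow> 'k) \<Rightarrow> ('n, 'x) nset \<Rightarrow> ('n, ('n set \<times> 'x) set) nset" where
  "abs_nset srt X =
     \<lparr>elems = elems (prod_nset fin_names X) // alpha srt X,
      act = (\<lambda>\<pi>. image (act (prod_nset fin_names X) \<pi>))\<rparr>"


section \<open>Nominal transition systems\<close>

record ('n, 's, 'p, 'a) nts =
  states :: "('n, 's) nset"
  preds :: "('n, 'p) nset"
  acts :: "('n, 'a) nset"
  sat :: "('s \<times> 'p) set"
  bn :: "'a \<Rightarrow> 'n set"
  transitions :: "('s \<times> ('n set \<times> ('a \<times> 's)) set) set"

definition is_nts :: "('n \<Rightarrow> 'k) \<Rightarrow> ('n, 's, 'p, 'a) nts \<Rightarrow> bool" where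
  "is_nts srt T \<longleftrightarrow>
     name_sorting srt \<and>
     nominal_set srt (states T) \<and> nominal_set srt (preds T) \<and> nominal_set srt (acts T) \<and>
     sat T \<subseteq> elems (states T) \<times> elems (preds T) \<and>
     equivariant srt (states T) (preds T) (sat T) \<and>
     equivariant_fun srt (acts T) fin_names (bn T) \<and>
     (\<forall>\<alpha>\<in>elems (acts T). finite (bn T \<alpha>) \<and> bn T \<alpha> \<subseteq> supp srt (acts T) \<alpha>) \<and>
     transitions T \<subseteq>
       elems (states T) \<times> elems (abs_nset srt (prod_nset (acts T) (states T))) \<and>
     equivariant srt (states T) (abs_nset srt (prod_nset (acts T) (states T))) (transitions T) \<and>
     (\<forall>P N \<alpha> Q. (P, absc srt (prod_nset (acts T) (states T)) N (\<alpha>, Q)) \<in> transitions T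
        \<longrightarrow> N = bn T \<alpha>)"

definition step :: "('n \<Rightarrow> 'k) \<Rightarrow> ('n, 's, 'p, 'a) nts \<Rightarrow> 's \<Rightarrow> 'a \<Rightarrow> 's \<Rightarrow> bool" where
  "step srt T P \<alpha> P' \<longleftrightarrow>
     (P, absc srt (prod_nset (acts T) (states T)) (bn T \<alpha>) (\<alpha>, P')) \<in> transitions T"

definition bisimulation :: "('n \<Rightarrow> 'k) \<Rightarrow> ('n, 's, 'p, 'a) nts \<Rightarrow> ('s \<times> 's) set \<Rightarrow> bool" where
  "bisimulation srt T R \<longleftrightarrow>
     R \<subseteq> elems (states T) \<times> elems (states T) \<and> sym R \<and>
     (\<forall>P Q. (P, Q) \<in> R \<longrightarrow>
        (\<forall>\<phi>\<in>elems (preds T). (P, \<phi>) \<in> sat T \<longrightarrow> (Q, \<phi>) \<in> sat T) \<and>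
        (\<forall>\<alpha>\<in>elems (acts T). \<forall>P'\<in>elems (states T).
           (\<forall>a\<in>bn T \<alpha>. fresh srt (states T) a Q) \<and> step srt T P \<alpha> P' \<longrightarrow>
           (\<exists>Q'\<in>elems (states T). step srt T Q \<alpha> Q' \<and> (P', Q') \<in> R)))"

definition bisimilar :: "('n \<Rightarrow> 'k) \<Rightarrow> ('n, 's, 'p, 'a) nts \<Rightarrow> 's \<Rightarrow> 's \<Rightarrow> bool" where
  "bisimilar srt T P Q \<longleftrightarrow> (\<exists>R. bisimulation srt T R \<and> (P, Q) \<in> R)"


section \<open>Turning state predicates into actions\<close>

definition pred_to_act ::
    "('n \<Rightarrow> 'k) \<Rightarrow> ('n, 's, 'p, 'a) nts \<Rightarrow> ('n, 's, 'p, 'a + 'p) nts" where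
  "pred_to_act srt T =
     (let A = sum_nset (acts T) (preds T); AS = prod_nset A (states T) in
      \<lparr>states = states T,
       preds = \<lparr>elems = {}, act = act (preds T)\<rparr>,
       acts = A,
       sat = {},
       bn = case_sum (bn T) (\<lambda>\<phi>. {}),
       transitions =
         {(P, absc srt AS (bn T \<alpha>) (Inl \<alpha>, P')) | P \<alpha> P'. step srt T P \<alpha> P'} \<union>
         {(P, absc srt AS {} (Inr \<phi>, P)) | P \<phi>. (P, \<phi>) \<in> sat T}\<rparr>)"

end

theory Submission
  imports Defs
begin

text \<open>
  A bisimulation for \<open>\<S>(T)\<close> is itself one for \<open>T\<close>, because both systems have the same steps
  labelled by the actions of \<open>T\<close>, and \<open>P \<turnstile> \<phi>\<close> in \<open>T\<close> exactly if \<open>P\<close> has some \<open>\<phi>\<close>-step in \<open>\<S>(T)\<close>.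
  Transitions are given up to alpha equivalence. For actions, \<open>Inl\<close> induces an injection between
  the two sets of classes. For predicates nothing is bound, so the class is a singleton; this is
  where it is needed that the least support is itself a support.
\<close>

lemma perms_one: "1 \<in> perms srt"
  by (simp add: perms_def)

lemma perms_times: "\<pi> \<in> perms srt \<Longrightarrow> \<sigma> \<in> perms srt \<Longrightarrow> \<pi> * \<sigma> \<in> perms srt"
  by (simp add: perms_def Perm.apply_times)

lemma perms_swap: "srt a = srt b \<Longrightarrow> Perm.swap a b \<in> perms srt"
  by (auto simp: perms_def swap.rep_eq transpose_def)

text \<open>
  Conjugating by the transposition of \<open>a\<close> with a fresh \<open>c\<close>, which fixes \<open>x\<close> because it fixes \<open>M\<close>,
  makes a permutation that fixes \<open>N - {a}\<close> fix \<open>a\<close> as well.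
\<close>

lemma supports_remove:
  assumes srt: "name_sorting srt" and X: "nominal_set srt X" and x: "x \<in> elems X"
    and N: "finite N" "supports srt X N x" and M: "finite M" "supports srt X M x"
    and a: "a \<notin> M"
  shows "supports srt X (N - {a}) x"
  unfolding supports_def
proof (intro ballI impI)
  fix \<pi> assume \<pi>: "\<pi> \<in> perms srt" and fix_\<pi>: "\<forall>b\<in>N - {a}. Perm.apply \<pi> b = b"
  \<comment> \<open>The names moved by \<open>\<pi>\<close> are avoided too, so that
    \<open>\<pi>\<close> fixes \<open>c\<close>; the sort of \<open>a\<close> is required of
    \<open>c\<close> so that their swap respects sorts.\<close>
  have "finite (N \<union> M \<union> {a} \<union> Perm.affected \<pi>)"
    using N M by simp
  moreover have "infinite {b. srt b = srt a}"
    using srt by (simp add: name_sorting_def)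
  ultimately have "\<not> {b. srt b = srt a} \<subseteq> N \<union> M \<union> {a} \<union> Perm.affected \<pi>"
    using finite_subset by blast
  then obtain c where "srt c = srt a" "c \<notin> N \<union> M \<union> {a} \<union> Perm.affected \<pi>"
    by blast
  then have c: "srt c = srt a" "c \<notin> N" "c \<notin> M" "c \<noteq> a" "Perm.apply \<pi> c = c"
    by (simp_all add: Perm.in_affected)
  define \<tau> where "\<tau> = Perm.swap a c"
  have \<tau>: "\<tau> \<in> perms srt"
    unfolding \<tau>_def using c(1) by (intro perms_swap) simp
  have \<tau>x: "act X \<tau> x = x"
    using M(2) \<tau> a c(3) by (auto simp: supports_def \<tau>_def swap.rep_eq transpose_def)
  have \<tau>\<tau>: "\<tau> * \<tau> = 1"
    by (simp add: \<tau>_def)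
  have "\<forall>b\<in>N. Perm.apply (\<tau> * (\<pi> * \<tau>)) b = b"
    using fix_\<pi> c by (auto simp: \<tau>_def Perm.apply_times swap.rep_eq transpose_def)
  then have "act X (\<tau> * (\<pi> * \<tau>)) x = x"
    using N(2) \<pi> \<tau> by (auto simp: supports_def intro: perms_times)
  moreover have "act X (\<rho> * \<sigma>) x = act X \<rho> (act X \<sigma> x)"
    if "\<rho> \<in> perms srt" "\<sigma> \<in> perms srt" for \<rho> \<sigma>
    using X x that unfolding nominal_set_def by blast
  \<comment> \<open>The conjugate and the two outer swaps all fix \<open>x\<close>, and the four
    copies of \<open>\<tau>\<close> cancel in pairs, leaving \<open>\<pi>\<close>.\<close>
  ultimately have "act X (\<tau> * ((\<tau> * (\<pi> * \<tau>)) * \<tau>)) x = x"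
    using \<pi> \<tau> \<tau>x by (simp add: perms_times)
  moreover have "\<tau> * ((\<tau> * (\<pi> * \<tau>)) * \<tau>) = (\<tau> * \<tau>) * \<pi> * (\<tau> * \<tau>)"
    by (simp only: mult.assoc)
  ultimately show "act X \<pi> x = x"
    by (simp add: \<tau>\<tau>)
qed

text \<open>A finite support of least cardinality lies inside every other finite support: a name
  outside the other one could be deleted by \<open>supports_remove\<close>. The intersection is
  therefore that minimal support.\<close>

lemma supp_supports:
  assumes srt: "name_sorting srt" and X: "nominal_set srt X" and x: "x \<in> elems X"
  shows "supports srt X (supp srt X x) x"
proof -
  let ?S = "\<lambda>N. finite N \<and> supports srt X N x"
  obtain N0 where "?S N0"
    using X x unfolding nominal_set_def by blast
  then obtain N where N: "?S N" and min: "\<And>M. ?S M \<Longrightarrow> card N \<le> card M"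
    using ex_has_least_nat[of ?S N0 card] by blast
  have "N \<subseteq> M" if M: "?S M" for M
  proof
    fix a assume "a \<in> N"
    show "a \<in> M"
    proof (rule ccontr)
      assume "a \<notin> M"
      with supports_remove[OF srt X x] N M have "?S (N - {a})"
        by blast
      with min have "card N \<le> card (N - {a})" .
      with \<open>a \<in> N\<close> N show False
        by (metis card_Diff1_less not_less)
    qed
  qed
  with N have "supp srt X x = N"
    by (auto simp: supp_def)
  with N show ?thesis by simp
qed

lemma nominal_set_prod_nset:
  assumes X: "nominal_set srt X" and Y: "nominal_set srt Y"
  shows "nominal_set srt (prod_nset X Y)"
proof -
  have "\<exists>N. finite N \<and> supports srt (prod_nset X Y) N (x, y)"
    if x: "x \<in> elems X" and y: "y \<in> elems Y" for x y
  proof -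
    obtain N where "finite N" "supports srt X N x"
      using x X unfolding nominal_set_def by blast
    moreover obtain M where "finite M" "supports srt Y M y"
      using y Y unfolding nominal_set_def by blast
    ultimately have "finite (N \<union> M) \<and> supports srt (prod_nset X Y) (N \<union> M) (x, y)"
      by (auto simp: supports_def prod_nset_def)
    then show ?thesis by blast
  qed
  with X Y show ?thesis
    by (auto simp: nominal_set_def prod_nset_def)
qed

lemma nominal_set_sum_nset:
  "nominal_set srt X \<Longrightarrow> nominal_set srt Y \<Longrightarrow> nominal_set srt (sum_nset X Y)"
  by (auto simp: nominal_set_def sum_nset_def supports_def)

lemma absc_refl:
  assumes "nominal_set srt X" "x \<in> elems X" "finite N"
  shows "(N, x) \<in> absc srt X N x"
  using assms
  by (auto simp: absc_def alpha_def prod_nset_def fin_names_def Fpow_def nominal_set_def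
      intro!: bexI[OF _ perms_one])

text \<open>With nothing bound, the renaming must fix the whole support of \<open>x\<close>, and
  hence \<open>x\<close>.\<close>

lemma absc_empty_binder:
  assumes srt: "name_sorting srt" and X: "nominal_set srt X"
    and y: "(N, y) \<in> absc srt X {} x"
  shows "y = x"
proof -
  from y obtain \<pi> where x: "x \<in> elems X" and \<pi>: "\<pi> \<in> perms srt" "act X \<pi> x = y"
      and "\<forall>a\<in>supp srt X x. Perm.apply \<pi> a = a"
    by (auto simp: absc_def alpha_def prod_nset_def)
  with supp_supports[OF srt X x] show ?thesis
    by (auto simp: supports_def)
qed

lemma supp_prod_sum_Inl:
  "supp srt (prod_nset (sum_nset A B) S) (Inl \<alpha>, P) = supp srt (prod_nset A S) (\<alpha>, P)"
  by (simp add: supp_def supports_def prod_nset_def sum_nset_def)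

text \<open>Permutations never leave a summand, and tagging with \<open>Inl\<close> preserves
  supports, so the same permutations witness alpha equivalence on both sides.\<close>

lemma absc_prod_sum_Inl:
  "absc srt (prod_nset (sum_nset A B) S) N (Inl \<alpha>, P) =
     map_prod id (map_prod Inl id) ` absc srt (prod_nset A S) N (\<alpha>, P)"
proof -
  have "((N, Inl \<alpha>, P), (M, y, Q)) \<in> alpha srt (prod_nset (sum_nset A B) S) \<longleftrightarrow>
      (\<exists>\<beta>. y = Inl \<beta> \<and> ((N, \<alpha>, P), (M, \<beta>, Q)) \<in> alpha srt (prod_nset A S))" for M y Q
    unfolding alpha_def
    by (cases y) (auto simp: supp_prod_sum_Inl, auto simp: prod_nset_def sum_nset_def)
  then show ?thesis
    by (force simp: absc_def)
qed

lemma pred_to_act_simps: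
  "states (pred_to_act srt T) = states T"
  "acts (pred_to_act srt T) = sum_nset (acts T) (preds T)"
  "bn (pred_to_act srt T) (Inl \<alpha>) = bn T \<alpha>"
  "bn (pred_to_act srt T) (Inr \<phi>) = {}"
  by (simp_all add: pred_to_act_def Let_def)

text \<open>A transition records only a class, so a step is known through an equation between
  classes whose representatives may differ. The next lemmas solve these equations.\<close>

lemma step_pred_to_act_iff:
  fixes srt :: "'n \<Rightarrow> 'k" and T :: "('n, 's, 'p, 'a) nts"
  defines "A \<equiv> absc srt (prod_nset (sum_nset (acts T) (preds T)) (states T))"
  shows "step srt (pred_to_act srt T) P x P' \<longleftrightarrow>
    (\<exists>\<beta> P''. A (bn (pred_to_act srt T) x) (x, P') = A (bn T \<beta>) (Inl \<beta>, P'') \<and> step srt T P \<beta> P'') \<or>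
    (\<exists>\<phi>. A (bn (pred_to_act srt T) x) (x, P') = A {} (Inr \<phi>, P) \<and> (P, \<phi>) \<in> sat T)"
proof -
  have "transitions (pred_to_act srt T) =
      {(P, A (bn T \<alpha>) (Inl \<alpha>, P')) | P \<alpha> P'. step srt T P \<alpha> P'} \<union>
      {(P, A {} (Inr \<phi>, P)) | P \<phi>. (P, \<phi>) \<in> sat T}"
    by (simp add: pred_to_act_def A_def Let_def)
  then show ?thesis
    unfolding step_def[of srt "pred_to_act srt T" P x P'] pred_to_act_simps A_def[symmetric]
    by simp
qed

lemma nominal_set_pred_to_act:
  assumes "is_nts srt T"
  shows "nominal_set srt (prod_nset (sum_nset (acts T) (preds T)) (states T))"
  using assms by (simp add: is_nts_def nominal_set_prod_nset nominal_set_sum_nset)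

text \<open>Every member of the left class is tagged \<open>Inl\<close>. The carrier assumptions on
  \<open>\<phi>\<close> and \<open>Q\<close> make the right class nonempty; two empty classes would
  be equal.\<close>

lemma absc_Inl_neq_Inr:
  assumes "nominal_set srt (prod_nset (sum_nset A B) S)"
    and "\<phi> \<in> elems B" "Q \<in> elems S"
  shows "absc srt (prod_nset (sum_nset A B) S) N (Inl \<alpha>, P) \<noteq>
    absc srt (prod_nset (sum_nset A B) S) {} (Inr \<phi>, Q)"
proof -
  have "({}, Inr \<phi>, Q) \<in> absc srt (prod_nset (sum_nset A B) S) {} (Inr \<phi>, Q)"
    using assms by (intro absc_refl) (auto simp: prod_nset_def sum_nset_def)
  moreover have "({}, Inr \<phi>, Q) \<notin> absc srt (prod_nset (sum_nset A B) S) N (Inl \<alpha>, P)"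
    by (auto simp: absc_prod_sum_Inl)
  ultimately show ?thesis by blast
qed

lemma step_pred_to_act_Inl:
  fixes T :: "('n, 's, 'p, 'a) nts"
  assumes T: "is_nts srt T"
  shows "step srt (pred_to_act srt T) P (Inl \<alpha>) P' \<longleftrightarrow> step srt T P \<alpha> P'"
proof
  let ?A = "absc srt (prod_nset (sum_nset (acts T) (preds T)) (states T))"
  let ?B = "absc srt (prod_nset (acts T) (states T))"
  assume "step srt (pred_to_act srt T) P (Inl \<alpha>) P'"
  then consider
      (act) \<beta> P'' where "?A (bn T \<alpha>) (Inl \<alpha>, P') = ?A (bn T \<beta>) (Inl \<beta>, P'')" "step srt T P \<beta> P''"
    | (pred) \<phi> where "?A (bn T \<alpha>) (Inl \<alpha>, P') = ?A {} (Inr \<phi>, P)" "(P, \<phi>) \<in> sat T"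
    unfolding step_pred_to_act_iff pred_to_act_simps by blast
  then show "step srt T P \<alpha> P'"
  proof cases
    case act
    \<comment> \<open>Images under an injection determine the classes, so the equation descends to
      \<open>T\<close>.\<close>
    have "inj (map_prod (id :: 'n set \<Rightarrow> _) (map_prod (Inl :: 'a \<Rightarrow> 'a + 'p) (id :: 's \<Rightarrow> _)))"
      by (intro prod.inj_map inj_Inl inj_on_id)
    with act(1) have "?B (bn T \<alpha>) (\<alpha>, P') = ?B (bn T \<beta>) (\<beta>, P'')"
      by (simp add: absc_prod_sum_Inl inj_image_eq_iff)
    with act(2) show ?thesis by (simp add: step_def)
  next
    case pred
    then have "\<phi> \<in> elems (preds T)" "P \<in> elems (states T)"
      using T by (auto simp: is_nts_def)
    with pred(1) absc_Inl_neq_Inr[OF nominal_set_pred_to_act[OF T]] show ?thesis by blast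
  qed
next
  assume "step srt T P \<alpha> P'"
  then show "step srt (pred_to_act srt T) P (Inl \<alpha>) P'"
    unfolding step_pred_to_act_iff pred_to_act_simps by blast
qed

lemma step_pred_to_act_Inr:
  fixes T :: "('n, 's, 'p, 'a) nts"
  assumes T: "is_nts srt T" and \<phi>: "\<phi> \<in> elems (preds T)" and P': "P' \<in> elems (states T)"
  shows "step srt (pred_to_act srt T) P (Inr \<phi>) P' \<longleftrightarrow> P' = P \<and> (P, \<phi>) \<in> sat T"
proof
  let ?X = "prod_nset (sum_nset (acts T) (preds T)) (states T)"
  have X: "nominal_set srt ?X"
    using T by (rule nominal_set_pred_to_act)
  have srt: "name_sorting srt"
    using T by (simp add: is_nts_def)
  assume "step srt (pred_to_act srt T) P (Inr \<phi>) P'"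
  \<comment> \<open>The \<open>Inl\<close> alternative is impossible, so the step stems from some
    predicate \<open>\<psi>\<close>, identified with \<open>\<phi>\<close> only by comparing
    classes.\<close>
  then obtain \<psi> where eq: "absc srt ?X {} (Inr \<phi>, P') = absc srt ?X {} (Inr \<psi>, P)"
      and \<psi>: "(P, \<psi>) \<in> sat T"
    using absc_Inl_neq_Inr[OF X \<phi> P']
    unfolding step_pred_to_act_iff pred_to_act_simps by metis
  have "({}, Inr \<phi>, P') \<in> absc srt ?X {} (Inr \<phi>, P')"
    using \<phi> P' by (intro absc_refl[OF X]) (auto simp: prod_nset_def sum_nset_def)
  with eq absc_empty_binder[OF srt X] have "(Inr \<phi>, P') = (Inr \<psi> :: 'a + 'p, P)"
    by metis
  with \<psi> show "P' = P \<and> (P, \<phi>) \<in> sat T" by simp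
next
  assume "P' = P \<and> (P, \<phi>) \<in> sat T"
  then show "step srt (pred_to_act srt T) P (Inr \<phi>) P'"
    unfolding step_pred_to_act_iff pred_to_act_simps by blast
qed

lemma bisimulation_pred_to_act:
  assumes T: "is_nts srt T" and R: "bisimulation srt (pred_to_act srt T) R"
  shows "bisimulation srt T R"
proof -
  have sub: "R \<subseteq> elems (states T) \<times> elems (states T)" and "sym R"
    using R by (simp_all add: bisimulation_def pred_to_act_simps)
  have sim: "\<exists>Q'\<in>elems (states T). step srt (pred_to_act srt T) Q x Q' \<and> (P', Q') \<in> R"
    if "(P, Q) \<in> R" "x \<in> elems (sum_nset (acts T) (preds T))" "P' \<in> elems (states T)"
      "\<forall>a\<in>bn (pred_to_act srt T) x. fresh srt (states T) a Q"
      "step srt (pred_to_act srt T) P x P'" for P Q x P'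
    using R that unfolding bisimulation_def pred_to_act_simps by blast
  \<comment> \<open>The loop of \<open>P\<close> labelled \<open>\<phi>\<close> is the challenge;
    its freshness condition is vacuous since nothing is bound, and any answer by \<open>Q\<close>
    must be a loop witnessing \<open>\<phi>\<close> at \<open>Q\<close>.\<close>
  have "(Q, \<phi>) \<in> sat T" if "(P, Q) \<in> R" "\<phi> \<in> elems (preds T)" "(P, \<phi>) \<in> sat T" for P Q \<phi>
    using sim[of P Q "Inr \<phi>" P] that sub
    by (auto simp: pred_to_act_simps step_pred_to_act_Inr[OF T] sum_nset_def)
  moreover have "\<exists>Q'\<in>elems (states T). step srt T Q \<alpha> Q' \<and> (P', Q') \<in> R"
    if "(P, Q) \<in> R" "\<alpha> \<in> elems (acts T)" "P' \<in> elems (states T)"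
      "\<forall>a\<in>bn T \<alpha>. fresh srt (states T) a Q" "step srt T P \<alpha> P'" for P Q \<alpha> P'
    using sim[of P Q "Inl \<alpha>" P'] that
    by (auto simp: pred_to_act_simps step_pred_to_act_Inl[OF T] sum_nset_def)
  ultimately show ?thesis
    using sub \<open>sym R\<close> unfolding bisimulation_def by blast
qed

theorem theorem8p3:
  fixes srt :: "'n \<Rightarrow> 'k"
    and T :: "('n, 's, 'p, 'a) nts"
    and P Q :: 's
  assumes "is_nts srt T"
    and "P \<in> elems (states T)" and "Q \<in> elems (states T)"
    and "bisimilar srt (pred_to_act srt T) P Q"
  shows "bisimilar srt T P Q"
  using assms bisimulation_pred_to_act unfolding bisimilar_def by blast

end
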